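(* Let $f_k:\mathbb{R}^m\to\mathbb{R}^m$, $k=0,1,2,\dots$, be Lipschitz continuous and continuously differentiable maps and consider the system $x_{k+1}=f_k(x_k)$. Assume that $\mathcal{C}\subset\mathbb{R}^m$ is open, convex, and invariant under $\{f_k\}$. Also assume that there exists a norm $\|\cdot\|$ on $\mathbb{R}^m$ such that the system is sup-mean non-reactive (sup-mean contractive) on $\mathcal{C}$, i.e. $0\le\lambda:=\bar R_{\|\cdot\|}+1<1$. Then, for any two orbits $(x_0,x_1,\dots)$ and $(y_0,y_1,\dots)$ of the system with $x_0\neq y_0$ in $\mathcal{C}$, the following inequality holds for every $k\ge1$: $$\|x_k-y_k\|\le\lambda^k\|x_0-y_0\|.$$ That is, any two orbits converge to each other. In addition, the system admits at most one fixed point. Moreover, if the map is time independent, $f_k=f$ for all $k$, and $\mathcal{C}$ is compact, then the system admits a unique asymptotically stable fixed point in $\mathcal{C}$.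
   Context: An orbit of $x_{k+1}=f_k(x_k)$ is a sequence $(x_0,x_1,\dots)$ satisfying this recursion for all $k\ge0$. A set $\mathcal{C}\subseteq\mathbb{R}^m$ is invariant under $\{f_k\}$ if $x_0\in\mathcal{C}$ implies $x_k\in\mathcal{C}$ for all $k\ge1$. A fixed point of the system is a point $z$ with $f_k(z)=z$ for all $k$. For a norm $\|\cdot\|$ on $\mathbb{R}^m$, the reactivity of a Lipschitz map $f:\mathbb{R}^m\to\mathbb{R}^m$ is $r_{\|\cdot\|}[f]=L_{\|\cdot\|}[f]-1$, where $L_{\|\cdot\|}[f]=\sup_{x\neq y}\frac{\|f(x)-f(y)\|}{\|x-y\|}$ is the Lipschitz constant of $f$ (supremum over $x\ne y$ in $\mathbb{R}^m$). The sup-mean reactivity of $x_{k+1}=f_k(x_k)$ is $\bar R_{\|\cdot\|}=\sup_{N}\frac1N\sum_{k=0}^{N-1}r_{\|\cdot\|}[f_k]$. The system is called sup-mean contractive (equivalently, sup-mean non-reactive) on an invariant set $\mathcal{C}$ if there is a norm with $\bar R_{\|\cdot\|}<0$. When $f_k=f$ for all $k$, $\bar R_{\|\cdot\|}=r_{\|\cdot\|}[f]$.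
   Formalization: In the final claim, an open set that is also compact in R^m is empty, so no fixed point in C can exist; there C is instead assumed compact, convex, invariant and nonempty, without openness. *)

theory Defs
  imports "HOL-Analysis.Analysis"
begin

definition is_norm :: "('a::real_vector \<Rightarrow> real) \<Rightarrow> bool" where
  "is_norm nrm \<longleftrightarrow>
     (\<forall>x. 0 \<le> nrm x) \<and>
     (\<forall>x. nrm x = 0 \<longleftrightarrow> x = 0) \<and>
     (\<forall>c x. nrm (c *\<^sub>R x) = \<bar>c\<bar> * nrm x) \<and>
     (\<forall>x y. nrm (x + y) \<le> nrm x + nrm y)"

definition is_orbit :: "(nat \<Rightarrow> 'a \<Rightarrow> 'a) \<Rightarrow> (nat \<Rightarrow> 'a) \<Rightarrow> bool" where
  "is_orbit f x \<longleftrightarrow> (\<forall>k. x (Suc k) = f k (x k))"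

definition invariant_under :: "'a set \<Rightarrow> (nat \<Rightarrow> 'a \<Rightarrow> 'a) \<Rightarrow> bool" where
  "invariant_under C f \<longleftrightarrow> (\<forall>x. is_orbit f x \<longrightarrow> x 0 \<in> C \<longrightarrow> (\<forall>k\<ge>1. x k \<in> C))"

definition is_fixed_point :: "(nat \<Rightarrow> 'a \<Rightarrow> 'a) \<Rightarrow> 'a \<Rightarrow> bool" where
  "is_fixed_point f z \<longleftrightarrow> (\<forall>k. f k z = z)"

definition continuously_differentiable ::
    "('a::real_normed_vector \<Rightarrow> 'b::real_normed_vector) \<Rightarrow> bool" where
  "continuously_differentiable g \<longleftrightarrow>
     (\<exists>g' :: 'a \<Rightarrow> 'a \<Rightarrow>\<^sub>L 'b.
        (\<forall>x. (g has_derivative blinfun_apply (g' x)) (at x)) \<and> continuous_on UNIV g')"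

(* A real supremum: it is the intended value only if the quotients are bounded, i.e. for Lipschitz
   maps, and only if the space is not trivial. *)
definition lipschitz_const :: "('a::real_vector \<Rightarrow> real) \<Rightarrow> ('a \<Rightarrow> 'a) \<Rightarrow> real" where
  "lipschitz_const nrm g = (SUP (x, y)\<in>{(x, y). x \<noteq> y}. nrm (g x - g y) / nrm (x - y))"

definition reactivity :: "('a::real_vector \<Rightarrow> real) \<Rightarrow> ('a \<Rightarrow> 'a) \<Rightarrow> real" where
  "reactivity nrm g = lipschitz_const nrm g - 1"

(* Extended real, since the means of the reactivities need not be bounded above. *)
definition sup_mean_reactivity ::
    "('a::real_vector \<Rightarrow> real) \<Rightarrow> (nat \<Rightarrow> 'a \<Rightarrow> 'a) \<Rightarrow> ereal" where
  "sup_mean_reactivity nrm f =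
     (SUP N\<in>{1::nat..}. ereal ((1 / real N) * (\<Sum>k<N. reactivity nrm (f k))))"

(* Lyapunov stability together with local attractivity. In finite dimension the notion does not
   depend on the norm, so the library metric is used; perturbations of z range over the whole
   space, not only over a subset. *)
definition asymptotically_stable :: "('a::metric_space \<Rightarrow> 'a) \<Rightarrow> 'a \<Rightarrow> bool" where
  "asymptotically_stable g z \<longleftrightarrow>
     (\<forall>\<epsilon>>0. \<exists>\<delta>>0. \<forall>x. is_orbit (\<lambda>_. g) x \<longrightarrow> dist (x 0) z < \<delta> \<longrightarrow> (\<forall>k. dist (x k) z < \<epsilon>)) \<and>
     (\<exists>\<delta>>0. \<forall>x. is_orbit (\<lambda>_. g) x \<longrightarrow> dist (x 0) z < \<delta> \<longrightarrow> x \<longlonglongrightarrow> z)"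

end

theory Submission
  imports Defs
begin

text \<open>
  Telescoping the Lipschitz estimate along two orbits bounds their distance after \<open>N\<close> steps by the
  product of the first \<open>N\<close> Lipschitz constants. By the AM-GM inequality this product is at most the
  \<open>N\<close>-th power of their mean, that is, of the mean reactivity plus one.
\<close>

section \<open>Comparison of \<open>nrm\<close> with the Euclidean norm, and Lipschitz constants in
  \<open>nrm\<close>\<close>

lemma is_normD:
  assumes "is_norm nrm"
  shows is_norm_nonneg: "0 \<le> nrm x"
    and is_norm_eq_0_iff: "nrm x = 0 \<longleftrightarrow> x = 0"
    and is_norm_scaleR: "nrm (c *\<^sub>R x) = \<bar>c\<bar> * nrm x"
    and is_norm_triangle: "nrm (x + y) \<le> nrm x + nrm y"
  using assms by (simp_all add: is_norm_def)

lemma is_norm_sum_le: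
  assumes "is_norm nrm" "finite A"
  shows "nrm (\<Sum>a\<in>A. g a) \<le> (\<Sum>a\<in>A. nrm (g a))"
  using assms(2)
proof induction
  case empty
  then show ?case using is_norm_eq_0_iff[OF assms(1), of 0] by simp
next
  case (insert a A)
  then show ?case using is_norm_triangle[OF assms(1), of "g a" "sum g A"] by simp
qed

lemma is_norm_upper_bound:
  fixes nrm :: "'a::euclidean_space \<Rightarrow> real"
  assumes "is_norm nrm"
  shows "nrm x \<le> (\<Sum>b\<in>Basis. nrm b) * norm x"
proof -
  have "nrm x = nrm (\<Sum>b\<in>Basis. (x \<bullet> b) *\<^sub>R b)"
    by (simp add: euclidean_representation)
  also have "\<dots> \<le> (\<Sum>b\<in>Basis. \<bar>x \<bullet> b\<bar> * nrm b)"
    using is_norm_sum_le[OF assms finite_Basis, of "\<lambda>b. (x \<bullet> b) *\<^sub>R b"]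
    by (simp add: is_norm_scaleR[OF assms])
  also have "\<dots> \<le> (\<Sum>b\<in>Basis. norm x * nrm b)"
    by (intro sum_mono mult_right_mono Basis_le_norm is_norm_nonneg[OF assms])
  finally show ?thesis by (simp add: sum_distrib_left mult.commute)
qed

text \<open>The reverse triangle inequality and the upper bound make \<open>nrm\<close> Lipschitz in
  the Euclidean metric.\<close>

lemma is_norm_continuous_on:
  fixes nrm :: "'a::euclidean_space \<Rightarrow> real"
  assumes "is_norm nrm"
  shows "continuous_on S nrm"
proof -
  let ?M = "\<Sum>b\<in>Basis. nrm (b :: 'a)"
  have diff: "nrm x - nrm y \<le> ?M * dist x y" for x y
    using is_norm_triangle[OF assms, of "x - y" y] is_norm_upper_bound[OF assms, of "x - y"]
    by (simp add: dist_norm)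
  have "?M-lipschitz_on S nrm"
  proof (rule lipschitz_onI)
    fix x y
    show "dist (nrm x) (nrm y) \<le> ?M * dist x y"
      using diff[of x y] diff[of y x] by (auto simp: dist_real_def dist_commute abs_le_iff)
  qed (simp add: sum_nonneg is_norm_nonneg[OF assms])
  then show ?thesis by (rule lipschitz_on_continuous_on)
qed

text \<open>By continuity \<open>nrm\<close> attains its minimum on the compact unit sphere; the
  minimum is positive because the minimiser is nonzero, and homogeneity carries the bound to all
  vectors.\<close>

lemma is_norm_lower_bound:
  fixes nrm :: "'a::euclidean_space \<Rightarrow> real"
  assumes "is_norm nrm"
  obtains c where "c > 0" "\<And>x. c * norm x \<le> nrm x"
proof -
  have "sphere (0::'a) 1 \<noteq> {}" by simp
  then obtain u :: 'a where u: "u \<in> sphere 0 1" and min: "\<And>v. v \<in> sphere 0 1 \<Longrightarrow> nrm u \<le> nrm v"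
    using continuous_attains_inf[OF compact_sphere _ is_norm_continuous_on[OF assms]] by meson
  have "u \<noteq> 0" using u by auto
  then have pos: "nrm u > 0"
    using is_norm_nonneg[OF assms, of u] is_norm_eq_0_iff[OF assms, of u] by simp
  have "nrm u * norm x \<le> nrm x" for x
  proof (cases "x = 0")
    case False
    have "nrm u \<le> nrm (x /\<^sub>R norm x)" using False by (intro min) simp
    then show ?thesis using False by (simp add: is_norm_scaleR[OF assms] field_simps)
  qed (simp add: is_norm_nonneg[OF assms])
  with pos show ?thesis using that by blast
qed

text \<open>A real supremum bounds its elements only if they are bounded above. The Lipschitz
  hypothesis is Euclidean, so the two norm comparisons turn its constant \<open>L\<close> into the
  bound \<open>?M * L / c\<close> on the quotients in \<open>nrm\<close>.\<close>

lemma
  fixes nrm :: "'a::euclidean_space \<Rightarrow> real"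
  assumes "is_norm nrm" and "L-lipschitz_on UNIV g"
  shows lipschitz_const_ineq: "nrm (g x - g y) \<le> lipschitz_const nrm g * nrm (x - y)"
    and lipschitz_const_nonneg: "0 \<le> lipschitz_const nrm g"
proof -
  note nrm_nonneg = is_norm_nonneg[OF assms(1)]
  have nrm_pos: "nrm (v - w) > 0" if "v \<noteq> w" for v w
    using nrm_nonneg[of "v - w"] is_norm_eq_0_iff[OF assms(1), of "v - w"] that by simp
  obtain c where c: "c > 0" "\<And>x. c * norm x \<le> nrm x"
    using is_norm_lower_bound[OF assms(1)] by blast
  let ?M = "\<Sum>b\<in>Basis. nrm (b :: 'a)"
  let ?q = "\<lambda>(v, w). nrm (g v - g w) / nrm (v - w)"
  let ?D = "{(v, w :: 'a). v \<noteq> w}"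
  have "L \<ge> 0" using assms(2) by (rule lipschitz_on_nonneg)
  have M: "?M \<ge> 0" by (simp add: sum_nonneg nrm_nonneg)
  have "?q p \<le> ?M * L / c" if pD: "p \<in> ?D" for p
  proof -
    obtain v w where p: "p = (v, w)" "v \<noteq> w" using pD by auto
    have "nrm (g v - g w) \<le> ?M * norm (g v - g w)"
      by (rule is_norm_upper_bound[OF assms(1)])
    also have "\<dots> \<le> ?M * (L * norm (v - w))"
      using lipschitz_onD[OF assms(2), of v w] by (intro mult_left_mono M) (simp add: dist_norm)
    also have "\<dots> = ?M * L / c * (c * norm (v - w))"
      using c(1) by simp
    also have "\<dots> \<le> ?M * L / c * nrm (v - w)"
      using c M \<open>L \<ge> 0\<close> by (intro mult_left_mono) auto
    finally show ?thesis using p nrm_pos by (simp add: pos_divide_le_eq)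
  qed
  then have "bdd_above (?q ` ?D)" by (rule bdd_aboveI2)
  then have le: "nrm (g v - g w) / nrm (v - w) \<le> lipschitz_const nrm g" if "v \<noteq> w" for v w
    using cSUP_upper[of "(v, w)" ?D ?q] that unfolding lipschitz_const_def by simp
  show "nrm (g x - g y) \<le> lipschitz_const nrm g * nrm (x - y)"
  proof (cases "x = y")
    case True
    then show ?thesis using is_norm_eq_0_iff[OF assms(1), of 0] by simp
  next
    case False
    then show ?thesis using le nrm_pos by (simp add: pos_divide_le_eq[symmetric])
  qed
  \<comment> \<open>A supremum of nonnegative quotients is known to be nonnegative once there is a
    quotient at all; the pair of \<open>b\<close> and 0 provides one.\<close>
  obtain b :: 'a where "b \<in> Basis" using nonempty_Basis by blast
  then have "b \<noteq> 0" by auto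
  from le[OF this] show "0 \<le> lipschitz_const nrm g"
    using nrm_nonneg by (meson divide_nonneg_nonneg order_trans)
qed

section \<open>Contraction estimates along pairs of orbits\<close>

lemma prod_le_mean_power:
  fixes a :: "nat \<Rightarrow> real"
  assumes "\<And>k. 0 \<le> a k"
  shows "(\<Prod>k<N. a k) \<le> ((\<Sum>k<N. a k) / N) ^ N"
\<comment> \<open>For \<open>N = 0\<close> the mean is a division by zero, but its zeroth power is
  1, like the empty product.\<close>
proof (cases "N = 0")
  case False
  have nonneg: "0 \<le> (\<Prod>k<N. a k)" by (simp add: prod_nonneg assms)
  \<comment> \<open>AM-GM is phrased with the \<open>N\<close>-th root of the product.
    \<open>prod_zero_iff\<close> is withheld to keep the case assumption on the whole product from
    becoming one on single factors.\<close>
  have "(\<Prod>k<N. a k) = ((\<Prod>k<N. a k) powr (1 / N)) ^ N"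
    using False nonneg by (cases "(\<Prod>k<N. a k) = 0") (simp_all add: powr_power del: prod_zero_iff)
  also have "\<dots> \<le> ((\<Sum>k<N. a k) / N) ^ N"
    using arith_geom_mean[of "{..<N}" a] False assms
    by (intro power_mono) (auto simp: sum_divide_distrib)
  finally show ?thesis .
qed simp

lemma orbit_nrm_le_prod:
  fixes nrm :: "'a::euclidean_space \<Rightarrow> real"
  assumes "is_norm nrm" and "\<And>k. \<exists>L. L-lipschitz_on UNIV (f k)"
    and "is_orbit f x" "is_orbit f y"
  shows "nrm (x N - y N) \<le> (\<Prod>k<N. lipschitz_const nrm (f k)) * nrm (x 0 - y 0)"
proof (induction N)
  case (Suc N)
  obtain L where L: "L-lipschitz_on UNIV (f N)" using assms(2) by blast
  have "nrm (x (Suc N) - y (Suc N)) \<le> lipschitz_const nrm (f N) * nrm (x N - y N)"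
    using assms(3,4) lipschitz_const_ineq[OF assms(1) L] by (simp add: is_orbit_def)
  also have "\<dots> \<le> lipschitz_const nrm (f N) *
      ((\<Prod>k<N. lipschitz_const nrm (f k)) * nrm (x 0 - y 0))"
    by (intro mult_left_mono Suc lipschitz_const_nonneg[OF assms(1) L])
  finally show ?case by (simp add: mult_ac)
qed simp

lemma orbit_nrm_le_power:
  fixes nrm :: "'a::euclidean_space \<Rightarrow> real"
  assumes "is_norm nrm" and lip: "\<And>k. \<exists>L. L-lipschitz_on UNIV (f k)"
    and lam: "ereal lam = sup_mean_reactivity nrm f + 1"
    and "is_orbit f x" "is_orbit f y"
  shows "nrm (x N - y N) \<le> lam ^ N * nrm (x 0 - y 0)"
\<comment> \<open>The supremum starts at \<open>N = 1\<close>, so it says nothing about index 0,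
  where both sides agree anyway.\<close>
proof (cases "N = 0")
  case False
  let ?L = "\<lambda>k. lipschitz_const nrm (f k)"
  have L_nonneg: "0 \<le> ?L k" for k
    using lip lipschitz_const_nonneg[OF assms(1)] by blast
  have "ereal ((1 / real N) * (\<Sum>k<N. reactivity nrm (f k))) \<le> sup_mean_reactivity nrm f"
    unfolding sup_mean_reactivity_def using False by (intro SUP_upper) auto
  then have "ereal ((1 / real N) * (\<Sum>k<N. reactivity nrm (f k))) + 1 \<le> ereal lam"
    unfolding lam by (rule add_right_mono)
  then have "(1 / real N) * (\<Sum>k<N. reactivity nrm (f k)) + 1 \<le> lam"
    by (simp add: one_ereal_def)
  \<comment> \<open>Each reactivity is a Lipschitz constant minus 1, so the added 1 cancels exactly
    in the mean.\<close>
  then have mean: "(\<Sum>k<N. ?L k) / N \<le> lam"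
    using False by (simp add: reactivity_def sum_subtractf field_simps)
  have "nrm (x N - y N) \<le> (\<Prod>k<N. ?L k) * nrm (x 0 - y 0)"
    by (rule orbit_nrm_le_prod) fact+
  also have "\<dots> \<le> ((\<Sum>k<N. ?L k) / N) ^ N * nrm (x 0 - y 0)"
    by (intro mult_right_mono prod_le_mean_power L_nonneg is_norm_nonneg[OF assms(1)])
  also have "\<dots> \<le> lam ^ N * nrm (x 0 - y 0)"
    using mean by (intro mult_right_mono power_mono is_norm_nonneg[OF assms(1)])
      (auto intro!: divide_nonneg_nonneg sum_nonneg L_nonneg)
  finally show ?thesis .
qed simp

text \<open>Stability and convergence are stated in the library metric. Changing norms at both ends
  costs one factor \<open>K\<close>, which depends neither on the orbits nor on
  \<open>N\<close>.\<close>

lemma orbit_dist_le_power: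
  fixes nrm :: "'a::euclidean_space \<Rightarrow> real"
  assumes "is_norm nrm" and "\<And>k. \<exists>L. L-lipschitz_on UNIV (f k)"
    and "ereal lam = sup_mean_reactivity nrm f + 1" and "0 \<le> lam"
  obtains K where "K > 0"
    and "\<And>x y N. is_orbit f x \<Longrightarrow> is_orbit f y \<Longrightarrow> dist (x N) (y N) \<le> K * lam ^ N * dist (x 0) (y 0)"
proof -
  obtain c where c: "c > 0" "\<And>x. c * norm x \<le> nrm x"
    using is_norm_lower_bound[OF assms(1)] by blast
  \<comment> \<open>The summand 1 only loosens the bound and makes positivity immediate.\<close>
  let ?M = "1 + (\<Sum>b\<in>Basis. nrm (b :: 'a))"
  have M: "?M > 0" by (intro add_pos_nonneg sum_nonneg is_norm_nonneg[OF assms(1)]) simp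
  show ?thesis
  proof
    show "?M / c > 0" using c(1) M by simp
    fix x y N
    assume orbits: "is_orbit f x" "is_orbit f y"
    have "c * dist (x N) (y N) \<le> nrm (x N - y N)"
      using c(2) by (simp add: dist_norm)
    also have "\<dots> \<le> lam ^ N * nrm (x 0 - y 0)"
      by (rule orbit_nrm_le_power[OF assms(1-3) orbits])
    also have "\<dots> \<le> lam ^ N * (?M * dist (x 0) (y 0))"
      using is_norm_upper_bound[OF assms(1), of "x 0 - y 0"] assms(4)
      by (intro mult_left_mono) (simp_all add: dist_norm algebra_simps add_increasing)
    finally show "dist (x N) (y N) \<le> ?M / c * lam ^ N * dist (x 0) (y 0)"
      using c(1) by (simp add: field_simps)
  qed
qed

section \<open>Fixed points, attraction and stability\<close>

lemma is_orbit_fixed_point: "is_fixed_point f z \<Longrightarrow> is_orbit f (\<lambda>_. z)"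
  by (simp add: is_fixed_point_def is_orbit_def)

lemma orbit_dist_tendsto_0:
  assumes "\<And>N. dist (x N) (y N) \<le> K * lam ^ N * dist (x 0) (y 0)" and "0 \<le> lam" "lam < 1"
  shows "(\<lambda>N. dist (x N) (y N)) \<longlonglongrightarrow> 0"
proof (rule tendsto_sandwich[OF _ _ tendsto_const])
  show "(\<lambda>N. K * lam ^ N * dist (x 0) (y 0)) \<longlonglongrightarrow> 0"
    using assms(2,3) by (auto intro!: tendsto_mult_left_zero tendsto_mult_right_zero LIMSEQ_realpow_zero)
qed (use assms(1) in auto)

lemma asymptotically_stableI:
  assumes "K > 0" "0 \<le> lam" "lam < 1"
    and bound: "\<And>x N. is_orbit (\<lambda>_. g) x \<Longrightarrow> dist (x N) z \<le> K * lam ^ N * dist (x 0) z"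
  shows "asymptotically_stable g z"
  unfolding asymptotically_stable_def
proof (intro conjI allI impI)
  fix \<epsilon> :: real
  assume "\<epsilon> > 0"
  show "\<exists>\<delta>>0. \<forall>x. is_orbit (\<lambda>_. g) x \<longrightarrow> dist (x 0) z < \<delta> \<longrightarrow> (\<forall>k. dist (x k) z < \<epsilon>)"
  \<comment> \<open>Since \<open>lam ^ k\<close> is at most 1, an orbit never gets farther from
    \<open>z\<close> than \<open>K\<close> times its initial distance.\<close>
  proof (intro exI[of _ "\<epsilon> / K"] conjI allI impI)
    fix x k
    assume x: "is_orbit (\<lambda>_. g) x" "dist (x 0) z < \<epsilon> / K"
    have "dist (x k) z \<le> K * lam ^ k * dist (x 0) z" by (rule bound[OF x(1)])
    also have "\<dots> \<le> K * 1 * dist (x 0) z"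
      using assms by (intro mult_right_mono mult_left_mono power_le_one) auto
    also have "\<dots> < \<epsilon>" using x(2) assms(1) by (simp add: field_simps)
    finally show "dist (x k) z < \<epsilon>" .
  qed (use \<open>\<epsilon> > 0\<close> assms(1) in simp)
next
  have "x \<longlonglongrightarrow> z" if "is_orbit (\<lambda>_. g) x" for x
    using orbit_dist_tendsto_0[of x "\<lambda>_. z", OF bound[OF that] assms(2,3)]
    by (subst tendsto_dist_iff)
  then show "\<exists>\<delta>>0. \<forall>x. is_orbit (\<lambda>_. g) x \<longrightarrow> dist (x 0) z < \<delta> \<longrightarrow> x \<longlonglongrightarrow> z"
    \<comment> \<open>Attraction holds from every starting point, so the radius 1 is
      arbitrary.\<close>
    by (intro exI[of _ 1]) simp
qed

text \<open>Invariance speaks of whole orbits, so the point is extended to the orbit of its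
  iterates, which is read at index 1.\<close>

lemma invariant_under_image:
  assumes "invariant_under C (\<lambda>_. g)" "v \<in> C"
  shows "g v \<in> C"
proof -
  have "is_orbit (\<lambda>_. g) (\<lambda>k. (g ^^ k) v)" by (simp add: is_orbit_def)
  then have "(g ^^ 1) v \<in> C" using assms unfolding invariant_under_def by fastforce
  then show ?thesis by simp
qed

theorem proposition1:
  fixes f :: "nat \<Rightarrow> real ^ 'm \<Rightarrow> real ^ 'm"
    and C :: "(real ^ 'm) set"
    and nrm :: "real ^ 'm \<Rightarrow> real"
    and lam :: real
  assumes lipschitz: "\<And>k. \<exists>L. L-lipschitz_on UNIV (f k)"
    and C1: "\<And>k. continuously_differentiable (f k)"
    and "convex C"
    and "invariant_under C f"
    and "is_norm nrm"
    and "ereal lam = sup_mean_reactivity nrm f + 1"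
    and "0 \<le> lam"
    and "lam < 1"
  shows "(open C \<longrightarrow>
            (\<forall>x y. is_orbit f x \<longrightarrow> is_orbit f y \<longrightarrow> x 0 \<in> C \<longrightarrow> y 0 \<in> C \<longrightarrow> x 0 \<noteq> y 0 \<longrightarrow>
               (\<forall>k\<ge>1. nrm (x k - y k) \<le> lam ^ k * nrm (x 0 - y 0)) \<and>
               (\<lambda>k. dist (x k) (y k)) \<longlonglongrightarrow> 0) \<and>
            (\<forall>z w. is_fixed_point f z \<longrightarrow> is_fixed_point f w \<longrightarrow> z = w)) \<and>
         (\<forall>g. (\<forall>k. f k = g) \<longrightarrow> compact C \<longrightarrow> C \<noteq> {} \<longrightarrow>
            (\<exists>z\<in>C. is_fixed_point f z \<and> asymptotically_stable g z \<and>
               (\<forall>w\<in>C. is_fixed_point f w \<longrightarrow> w = z)))"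
proof -
  note nrm_le = orbit_nrm_le_power[OF \<open>is_norm nrm\<close> lipschitz \<open>ereal lam = _\<close>]
  obtain K where K: "K > 0"
    and dist_le: "\<And>x y N. is_orbit f x \<Longrightarrow> is_orbit f y \<Longrightarrow>
      dist (x N) (y N) \<le> K * lam ^ N * dist (x 0) (y 0)"
    using orbit_dist_le_power[OF \<open>is_norm nrm\<close> lipschitz \<open>ereal lam = _\<close> \<open>0 \<le> lam\<close>] by blast
  have conv: "(\<lambda>k. dist (x k) (y k)) \<longlonglongrightarrow> 0" if "is_orbit f x" "is_orbit f y" for x y
    using orbit_dist_tendsto_0[OF dist_le[OF that] \<open>0 \<le> lam\<close> \<open>lam < 1\<close>] .
  \<comment> \<open>Two fixed points are constant orbits; their constant distance tends to 0 and
    hence vanishes. This covers the whole space, not only \<open>C\<close>.\<close>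
  have unique: "z = w" if "is_fixed_point f z" "is_fixed_point f w" for z w
    using conv[OF that[THEN is_orbit_fixed_point]] by (simp add: LIMSEQ_const_iff)
  have "\<exists>z\<in>C. is_fixed_point f z \<and> asymptotically_stable g z \<and>
      (\<forall>w\<in>C. is_fixed_point f w \<longrightarrow> w = z)"
    if "\<forall>k. f k = g" "compact C" "C \<noteq> {}" for g
  proof -
    have f: "f = (\<lambda>_. g)" using that(1) by auto
    have "continuous_on C g"
      using lipschitz[of 0] lipschitz_on_continuous_on[of _ UNIV g] continuous_on_subset[of UNIV g C]
      by (auto simp: f)
    moreover have "g \<in> C \<rightarrow> C"
      using invariant_under_image[of C g] \<open>invariant_under C f\<close> by (simp add: f)
    \<comment> \<open>Existence comes from Brouwer's theorem on the compact convex set; the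
      contraction estimate then supplies uniqueness and stability.\<close>
    ultimately obtain z where z: "z \<in> C" "g z = z"
      using brouwer[OF \<open>compact C\<close> \<open>convex C\<close> \<open>C \<noteq> {}\<close>, of g] by blast
    then have fixed: "is_fixed_point f z" by (simp add: is_fixed_point_def f)
    \<comment> \<open>The estimate is applied to an arbitrary orbit and the constant orbit at
      \<open>z\<close>. The arbitrary orbit may start outside \<open>C\<close>, as the definition of
      stability demands.\<close>
    have "asymptotically_stable g z"
    proof (rule asymptotically_stableI[OF K \<open>0 \<le> lam\<close> \<open>lam < 1\<close>])
      fix x N
      assume "is_orbit (\<lambda>_. g) x"
      then show "dist (x N) z \<le> K * lam ^ N * dist (x 0) z"
        using dist_le[OF _ is_orbit_fixed_point[OF fixed]] by (simp add: f)
    qed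
    with z fixed unique show ?thesis by blast
  qed
  then show ?thesis using nrm_le conv unique by blast
qed

end
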